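(* Let $\diamond$ be a left-continuous t-norm with $\alpha\diamond\alpha\ge\alpha$ for all $\alpha\in[0,1]$, and let $(X,\mathcal{F},\tau_\diamond)$ be a complete PM space, where $\tau_\diamond(F,G)(x)=F(x)\diamond G(x)$ for all $F,G\in\Delta^+$ and $x\ge 0$. Let $f:X\to X$ be a probabilistic TSR-contraction mapping; that is, for every $t>0$ there exists $k\in(0,1)$ such that $$1-F_{f(x),f(y)}(kt)\le k\bigl(1-F_{x,y}(t)\bigr)\quad\text{for all }x,y\in X.$$ Then $f$ has a unique fixed point in $X$.
   Context: A t-norm is a binary operation $\diamond$ on $[0,1]$ that is commutative, associative, non-decreasing in each argument, and satisfies $x\diamond 1=x$. A distance distribution function is a non-decreasing function $F:[-\infty,\infty]\to[0,1]$, left continuous on $\mathbb{R}$, with $F(-\infty)=0$, $F(\infty)=1$, $F(0)=0$; the set of these is $\Delta^+$. $H_0\in\Delta^+$ is given by $H_0(u)=0$ for $u\le 0$ and $H_0(u)=1$ for $u>0$. A triangle function is a binary operation $\tau$ on $\Delta^+$ that is commutative, associative, non-decreasing in each place (pointwise order), with identity $H_0$. A probabilistic metric space (PM space) is a triple $(X,\mathcal{F},\tau)$ with $X$ a nonempty set, $\tau$ a triangle function, and $\mathcal{F}:X\times X\to\Delta^+$, $(p,q)\mapsto F_{p,q}$, such that for all $p,q,r\in X$: (i) $F_{p,q}=H_0$ iff $p=q$; (ii) $F_{p,q}=F_{q,p}$; (iii) $F_{p,r}\ge\tau(F_{p,q},F_{q,r})$. A sequence $\{x_n\}$ in $X$ converges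 to $x\in X$ if for all $\alpha\in(0,1)$ and $t>0$ there is a natural number $m$ with $F_{x_n,x}(t)>1-\alpha$ for all $n\ge m$. It is a Cauchy sequence if for all $\alpha\in(0,1)$ and $t>0$ there is a natural number $m$ with $F_{x_{n+p},x_n}(t)>1-\alpha$ for all $n\ge m$ and all natural numbers $p$. The space is complete if every Cauchy sequence converges to a point of $X$. The contraction constant $k$ may depend on $t$ but not on $x,y$. *)

theory Defs
  imports Complex_Main "HOL-Library.Extended_Real" "HOL-Library.FuncSet"
begin

text \<open>A binary operation on the unit interval is a function on the reals of which only the
  values on the unit square matter.\<close>

definition t_norm :: "(real \<Rightarrow> real \<Rightarrow> real) \<Rightarrow> bool" where
  "t_norm T \<longleftrightarrow>
     (\<forall>x\<in>{0..1}. \<forall>y\<in>{0..1}. T x y \<in> {0..1}) \<and>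
     (\<forall>x\<in>{0..1}. \<forall>y\<in>{0..1}. T x y = T y x) \<and>
     (\<forall>x\<in>{0..1}. \<forall>y\<in>{0..1}. \<forall>z\<in>{0..1}. T (T x y) z = T x (T y z)) \<and>
     (\<forall>x\<in>{0..1}. \<forall>x'\<in>{0..1}. \<forall>y\<in>{0..1}. \<forall>y'\<in>{0..1}.
        x \<le> x' \<longrightarrow> y \<le> y' \<longrightarrow> T x y \<le> T x' y') \<and>
     (\<forall>x\<in>{0..1}. T x 1 = x)"

text \<open>Left continuity of a t-norm is meant in each argument; by commutativity it suffices to
  require it in the first. At a point of the half-open interval from 0 to 1, only arguments
  inside the unit interval enter the left limit.\<close>

definition left_continuous_t_norm :: "(real \<Rightarrow> real \<Rightarrow> real) \<Rightarrow> bool" where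
  "left_continuous_t_norm T \<longleftrightarrow>
     t_norm T \<and> (\<forall>y\<in>{0..1}. \<forall>x\<in>{0<..1}. continuous (at_left x) (\<lambda>u. T u y))"

text \<open>The set \<open>\<Delta>\<^sup>+\<close>.\<close>

definition distance_dfs :: "(ereal \<Rightarrow> real) set" where
  "distance_dfs =
     {F. range F \<subseteq> {0..1} \<and> mono F \<and>
         (\<forall>r::real. continuous (at_left (ereal r)) F) \<and>
         F (-\<infinity>) = 0 \<and> F \<infinity> = 1 \<and> F 0 = 0}"

definition H0 :: "ereal \<Rightarrow> real" where
  "H0 u = (if u \<le> 0 then 0 else 1)"

definition triangle_function ::
  "((ereal \<Rightarrow> real) \<Rightarrow> (ereal \<Rightarrow> real) \<Rightarrow> (ereal \<Rightarrow> real)) \<Rightarrow> bool" where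
  "triangle_function \<tau> \<longleftrightarrow>
     (\<forall>F\<in>distance_dfs. \<forall>G\<in>distance_dfs. \<tau> F G \<in> distance_dfs) \<and>
     (\<forall>F\<in>distance_dfs. \<forall>G\<in>distance_dfs. \<tau> F G = \<tau> G F) \<and>
     (\<forall>F\<in>distance_dfs. \<forall>G\<in>distance_dfs. \<forall>H\<in>distance_dfs. \<tau> (\<tau> F G) H = \<tau> F (\<tau> G H)) \<and>
     (\<forall>F\<in>distance_dfs. \<forall>F'\<in>distance_dfs. \<forall>G\<in>distance_dfs. \<forall>G'\<in>distance_dfs.
        F \<le> F' \<longrightarrow> G \<le> G' \<longrightarrow> \<tau> F G \<le> \<tau> F' G') \<and>
     (\<forall>F\<in>distance_dfs. \<tau> F H0 = F)"

text \<open>At negative arguments every member of \<open>\<Delta>\<^sup>+\<close> is 0.\<close>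

definition tau_of ::
  "(real \<Rightarrow> real \<Rightarrow> real) \<Rightarrow> (ereal \<Rightarrow> real) \<Rightarrow> (ereal \<Rightarrow> real) \<Rightarrow> (ereal \<Rightarrow> real)" where
  "tau_of T F G = (\<lambda>x. if x \<ge> 0 then T (F x) (G x) else 0)"

definition PM_space ::
  "'a set \<Rightarrow> ('a \<Rightarrow> 'a \<Rightarrow> ereal \<Rightarrow> real) \<Rightarrow>
   ((ereal \<Rightarrow> real) \<Rightarrow> (ereal \<Rightarrow> real) \<Rightarrow> (ereal \<Rightarrow> real)) \<Rightarrow> bool" where
  "PM_space X \<F> \<tau> \<longleftrightarrow>
     X \<noteq> {} \<and> triangle_function \<tau> \<and>
     (\<forall>p\<in>X. \<forall>q\<in>X. \<F> p q \<in> distance_dfs) \<and>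
     (\<forall>p\<in>X. \<forall>q\<in>X. \<F> p q = H0 \<longleftrightarrow> p = q) \<and>
     (\<forall>p\<in>X. \<forall>q\<in>X. \<F> p q = \<F> q p) \<and>
     (\<forall>p\<in>X. \<forall>q\<in>X. \<forall>r\<in>X. \<F> p r \<ge> \<tau> (\<F> p q) (\<F> q r))"

definition PM_converges :: "('a \<Rightarrow> 'a \<Rightarrow> ereal \<Rightarrow> real) \<Rightarrow> (nat \<Rightarrow> 'a) \<Rightarrow> 'a \<Rightarrow> bool" where
  "PM_converges \<F> s x \<longleftrightarrow>
     (\<forall>\<alpha>\<in>{0<..<1}. \<forall>t::real. t > 0 \<longrightarrow>
        (\<exists>m. \<forall>n\<ge>m. \<F> (s n) x (ereal t) > 1 - \<alpha>))"

definition PM_Cauchy :: "('a \<Rightarrow> 'a \<Rightarrow> ereal \<Rightarrow> real) \<Rightarrow> (nat \<Rightarrow> 'a) \<Rightarrow> bool" where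
  "PM_Cauchy \<F> s \<longleftrightarrow>
     (\<forall>\<alpha>\<in>{0<..<1}. \<forall>t::real. t > 0 \<longrightarrow>
        (\<exists>m. \<forall>n\<ge>m. \<forall>p. \<F> (s (n + p)) (s n) (ereal t) > 1 - \<alpha>))"

definition PM_complete :: "'a set \<Rightarrow> ('a \<Rightarrow> 'a \<Rightarrow> ereal \<Rightarrow> real) \<Rightarrow> bool" where
  "PM_complete X \<F> \<longleftrightarrow>
     (\<forall>s. range s \<subseteq> X \<longrightarrow> PM_Cauchy \<F> s \<longrightarrow> (\<exists>x\<in>X. PM_converges \<F> s x))"

definition TSR_contraction ::
  "'a set \<Rightarrow> ('a \<Rightarrow> 'a \<Rightarrow> ereal \<Rightarrow> real) \<Rightarrow> ('a \<Rightarrow> 'a) \<Rightarrow> bool" where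
  "TSR_contraction X \<F> f \<longleftrightarrow>
     (\<forall>t::real. t > 0 \<longrightarrow>
        (\<exists>k\<in>{0<..<1}. \<forall>x\<in>X. \<forall>y\<in>X.
           1 - \<F> (f x) (f y) (ereal (k * t)) \<le> k * (1 - \<F> x y (ereal t))))"

end

theory Submission imports Defs begin

text \<open>An idempotent t-norm is the minimum, so for every fixed \<open>t > 0\<close> the function
  \<open>d\<^sub>t(x, y) = 1 - F\<^sub>x\<^sub>,\<^sub>y(t)\<close> is a pseudo-ultrametric. Since \<open>d\<^sub>t\<close> decreases in \<open>t\<close>, the hypothesis
  on \<open>f\<close> gives \<open>d\<^sub>t(f x, f y) \<le> d\<^sub>k\<^sub>t(f x, f y) \<le> k d\<^sub>t(x, y)\<close>: \<open>f\<close> is a Banach contraction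
  for each \<open>d\<^sub>t\<close> separately, and the Picard iteration argument applies at each \<open>t\<close>.\<close>

text \<open>With \<open>m = min a b\<close>, the assumption gives \<open>m \<le> T m m\<close>, and
  monotonicity in both arguments raises this to \<open>T a b\<close>. This half of the identity
  \<open>T = min\<close> yields the ultrametric inequality.\<close>

lemma t_norm_idempotent_ge_min:
  assumes "t_norm T" and "\<And>\<alpha>. \<alpha> \<in> {0..1} \<Longrightarrow> T \<alpha> \<alpha> \<ge> \<alpha>"
    and "a \<in> {0..1}" and "b \<in> {0..1}"
  shows "min a b \<le> T a b"
proof -
  have m: "min a b \<in> {0..1}"
    using assms(3,4) by auto
  have "min a b \<le> T (min a b) (min a b)"
    using assms(2) m by blast
  also have "\<dots> \<le> T a b"
    using assms(1)[unfolded t_norm_def] assms(3,4) m min.cobounded1[of a b] min.cobounded2[of a b]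
    by blast
  finally show ?thesis .
qed

lemma distance_df_bounds:
  assumes "F \<in> distance_dfs"
  shows "0 \<le> F u" and "F u \<le> 1"
  using assms unfolding distance_dfs_def by (auto simp: image_subset_iff)

lemma distance_df_mono:
  assumes "F \<in> distance_dfs" and "u \<le> v"
  shows "F u \<le> F v"
  using assms unfolding distance_dfs_def by (blast dest: monoD)

text \<open>Monotonicity and \<open>F 0 = 0\<close> settle all nonpositive arguments, and the value
  at infinity is fixed by definition. Equality of points can therefore be tested at one positive
  real \<open>t\<close> at a time.\<close>

lemma distance_df_eq_H0I:
  assumes F: "F \<in> distance_dfs" and one: "\<And>t::real. t > 0 \<Longrightarrow> F (ereal t) = 1"
  shows "F = H0"
proof
  fix u :: ereal
  have "F 0 = 0" "F \<infinity> = 1"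
    using F unfolding distance_dfs_def by auto
  show "F u = H0 u"
  proof (cases "u \<le> 0")
    case True
    then have "F u \<le> 0"
      using distance_df_mono[OF F True] \<open>F 0 = 0\<close> by simp
    then show ?thesis
      using True distance_df_bounds(1)[OF F, of u] by (simp add: H0_def)
  next
    case False
    then show ?thesis
      using one \<open>F \<infinity> = 1\<close> by (cases u) (auto simp: H0_def)
  qed
qed

lemma PM_space_dfs:
  assumes "PM_space X \<F> \<tau>" and "p \<in> X" and "q \<in> X"
  shows "\<F> p q \<in> distance_dfs"
  using assms unfolding PM_space_def by blast

lemma PM_space_sym:
  assumes "PM_space X \<F> \<tau>" and "p \<in> X" and "q \<in> X"
  shows "\<F> p q = \<F> q p"
  using assms unfolding PM_space_def by blast

lemma PM_space_eqI:
  assumes "PM_space X \<F> \<tau>" and "p \<in> X" and "q \<in> X"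
    and "\<And>t::real. t > 0 \<Longrightarrow> \<F> p q (ereal t) = 1"
  shows "p = q"
proof -
  have "\<F> p q = H0"
    using PM_space_dfs[OF assms(1-3)] assms(4) by (rule distance_df_eq_H0I)
  then show ?thesis
    using assms(1-3) unfolding PM_space_def by blast
qed

lemma PM_space_refl:
  assumes "PM_space X \<F> \<tau>" and "p \<in> X" and "0 < t"
  shows "\<F> p p (ereal t) = 1"
proof -
  have "\<F> p p = H0"
    using assms(1,2) unfolding PM_space_def by blast
  then show ?thesis
    using assms(3) by (simp add: H0_def)
qed

text \<open>Since \<open>tau_of T\<close> acts pointwise, the triangle inequality compares all three
  functions at the same \<open>t\<close>, without splitting \<open>t\<close> into two
  summands.\<close>

lemma PM_space_ultrametric:
  assumes T: "t_norm T" "\<And>\<alpha>. \<alpha> \<in> {0..1} \<Longrightarrow> T \<alpha> \<alpha> \<ge> \<alpha>"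
    and PM: "PM_space X \<F> (tau_of T)"
    and X: "p \<in> X" "q \<in> X" "r \<in> X" and "0 \<le> t"
  shows "min (\<F> p q (ereal t)) (\<F> q r (ereal t)) \<le> \<F> p r (ereal t)"
proof -
  have "min (\<F> p q (ereal t)) (\<F> q r (ereal t)) \<le> T (\<F> p q (ereal t)) (\<F> q r (ereal t))"
    using T by (rule t_norm_idempotent_ge_min)
      (simp_all add: distance_df_bounds PM_space_dfs[OF PM] X)
  also have "\<dots> = tau_of T (\<F> p q) (\<F> q r) (ereal t)"
    using \<open>0 \<le> t\<close> by (simp add: tau_of_def)
  also have "\<dots> \<le> \<F> p r (ereal t)"
    using PM X unfolding PM_space_def le_fun_def by blast
  finally show ?thesis .
qed

text \<open>From \<open>k * t \<le> t\<close> and monotonicity of the distance distribution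
  function. As \<open>t\<close> stays fixed, the same \<open>k\<close> serves every later iterate,
  so its dependence on \<open>t\<close> does no harm.\<close>

lemma TSR_contraction_same_time:
  assumes PM: "PM_space X \<F> \<tau>" and f: "f \<in> X \<rightarrow> X" and C: "TSR_contraction X \<F> f" and "0 < t"
  obtains k where "0 < k" "k < 1"
    "\<And>x y. x \<in> X \<Longrightarrow> y \<in> X \<Longrightarrow> 1 - \<F> (f x) (f y) (ereal t) \<le> k * (1 - \<F> x y (ereal t))"
proof -
  obtain k where k: "0 < k" "k < 1"
    and c: "\<And>x y. x \<in> X \<Longrightarrow> y \<in> X \<Longrightarrow>
      1 - \<F> (f x) (f y) (ereal (k * t)) \<le> k * (1 - \<F> x y (ereal t))"
    using C \<open>0 < t\<close> unfolding TSR_contraction_def by (meson greaterThanLessThan_iff)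
  have "1 - \<F> (f x) (f y) (ereal t) \<le> k * (1 - \<F> x y (ereal t))" if "x \<in> X" "y \<in> X" for x y
  proof -
    have "f x \<in> X" "f y \<in> X"
      using f that by auto
    then have "\<F> (f x) (f y) (ereal (k * t)) \<le> \<F> (f x) (f y) (ereal t)"
      using k \<open>0 < t\<close> by (intro distance_df_mono PM_space_dfs[OF PM]) auto
    then show ?thesis
      using c[OF that] by linarith
  qed
  then show thesis
    using that k by blast
qed

lemma TSR_contraction_fixed_point_unique:
  assumes PM: "PM_space X \<F> \<tau>" and f: "f \<in> X \<rightarrow> X" and C: "TSR_contraction X \<F> f"
    and x: "x \<in> X" "f x = x" and y: "y \<in> X" "f y = y"
  shows "x = y"
proof (rule PM_space_eqI[OF PM x(1) y(1)])
  fix t :: real assume "0 < t"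
  then obtain k where "k < 1" and
    k: "\<And>x y. x \<in> X \<Longrightarrow> y \<in> X \<Longrightarrow> 1 - \<F> (f x) (f y) (ereal t) \<le> k * (1 - \<F> x y (ereal t))"
    using TSR_contraction_same_time[OF PM f C] by metis
  define d where "d = 1 - \<F> x y (ereal t)"
  \<comment> \<open>Both points are fixed, so the contraction inequality has the same distance on
    both sides.\<close>
  have "d \<le> k * d"
    using k[OF x(1) y(1)] x y by (simp add: d_def)
  then have "(1 - k) * d \<le> 0"
    by (simp add: algebra_simps)
  with \<open>k < 1\<close> have "d \<le> 0"
    by (simp add: mult_le_0_iff)
  then show "\<F> x y (ereal t) = 1"
    using distance_df_bounds(2)[OF PM_space_dfs[OF PM x(1) y(1)], of "ereal t"]
    by (simp add: d_def)
qed

lemma TSR_contraction_iterates_Cauchy: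
  assumes T: "t_norm T" "\<And>\<alpha>. \<alpha> \<in> {0..1} \<Longrightarrow> T \<alpha> \<alpha> \<ge> \<alpha>"
    and PM: "PM_space X \<F> (tau_of T)" and f: "f \<in> X \<rightarrow> X" and C: "TSR_contraction X \<F> f"
    and "x0 \<in> X"
  shows "PM_Cauchy \<F> (\<lambda>n. (f ^^ n) x0)"
  unfolding PM_Cauchy_def
proof (intro ballI allI impI)
  fix \<alpha> t :: real assume \<alpha>: "\<alpha> \<in> {0<..<1}" and "0 < t"
  define s where "s n = (f ^^ n) x0" for n
  have s: "s n \<in> X" for n
    unfolding s_def using f \<open>x0 \<in> X\<close> by (induction n) auto
  obtain k where k: "0 < k" "k < 1" and
    c: "\<And>x y. x \<in> X \<Longrightarrow> y \<in> X \<Longrightarrow> 1 - \<F> (f x) (f y) (ereal t) \<le> k * (1 - \<F> x y (ereal t))"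
    using TSR_contraction_same_time[OF PM f C \<open>0 < t\<close>] by metis
  \<comment> \<open>The induction starts from the trivial bound 1 on every distance, so no constant
    stands in front of \<open>k ^ n\<close>.\<close>
  have step: "1 - \<F> (s (Suc n)) (s n) (ereal t) \<le> k ^ n" for n
  proof (induction n)
    case 0
    then show ?case
      using distance_df_bounds(1)[OF PM_space_dfs[OF PM s s]] by simp
  next
    case (Suc n)
    have "1 - \<F> (s (Suc (Suc n))) (s (Suc n)) (ereal t) \<le> k * (1 - \<F> (s (Suc n)) (s n) (ereal t))"
      using c[OF s[of "Suc n"] s[of n]] by (simp add: s_def)
    also have "\<dots> \<le> k * k ^ n"
      using Suc k by (intro mult_left_mono) auto
    finally show ?case by simp
  qed
  \<comment> \<open>The ultrametric inequality replaces the usual geometric sum by a maximum, here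
    of \<open>k ^ (n + p)\<close> and \<open>k ^ n\<close>. The bound is thus uniform in
    \<open>p\<close>, as the Cauchy property demands.\<close>
  have tail: "1 - \<F> (s (n + p)) (s n) (ereal t) \<le> k ^ n" for n p
  proof (induction p)
    case 0
    then show ?case
      using k PM_space_refl[OF PM s \<open>0 < t\<close>] by simp
  next
    case (Suc p)
    have "k ^ (n + p) \<le> k ^ n"
      using k by (intro power_decreasing) auto
    then show ?case
      using Suc step[of "n + p"] \<open>0 < t\<close>
        PM_space_ultrametric[OF T PM s[of "n + Suc p"] s[of "n + p"] s[of n], of t]
      by (auto simp: min_def split: if_splits)
  qed
  have "(\<lambda>n. k ^ n) \<longlonglongrightarrow> 0"
    using k by (intro LIMSEQ_realpow_zero) auto
  then have "eventually (\<lambda>n. k ^ n < \<alpha>) sequentially"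
    using \<alpha> by (intro order_tendstoD(2)) auto
  then obtain m where m: "\<And>n. n \<ge> m \<Longrightarrow> k ^ n < \<alpha>"
    unfolding eventually_sequentially by blast
  show "\<exists>m. \<forall>n\<ge>m. \<forall>p. 1 - \<alpha> < \<F> ((f ^^ (n + p)) x0) ((f ^^ n) x0) (ereal t)"
  proof (intro exI allI impI)
    fix n p assume "m \<le> n"
    then have "k ^ n < \<alpha>"
      using m by blast
    then show "1 - \<alpha> < \<F> ((f ^^ (n + p)) x0) ((f ^^ n) x0) (ereal t)"
      using tail[where n = n and p = p, unfolded s_def] by linarith
  qed
qed

lemma TSR_contraction_limit_fixed:
  assumes T: "t_norm T" "\<And>\<alpha>. \<alpha> \<in> {0..1} \<Longrightarrow> T \<alpha> \<alpha> \<ge> \<alpha>"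
    and PM: "PM_space X \<F> (tau_of T)" and f: "f \<in> X \<rightarrow> X" and C: "TSR_contraction X \<F> f"
    and "x0 \<in> X" and "x \<in> X" and lim: "PM_converges \<F> (\<lambda>n. (f ^^ n) x0) x"
  shows "f x = x"
proof -
  define s where "s n = (f ^^ n) x0" for n
  have s: "s n \<in> X" for n
    unfolding s_def using f \<open>x0 \<in> X\<close> by (induction n) auto
  have fx: "f x \<in> X"
    using f \<open>x \<in> X\<close> by auto
  show ?thesis
  proof (rule PM_space_eqI[OF PM fx \<open>x \<in> X\<close>])
    fix t :: real assume "0 < t"
    obtain k where k: "0 < k" "k < 1" and
      c: "\<And>x y. x \<in> X \<Longrightarrow> y \<in> X \<Longrightarrow> 1 - \<F> (f x) (f y) (ereal t) \<le> k * (1 - \<F> x y (ereal t))"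
      using TSR_contraction_same_time[OF PM f C \<open>0 < t\<close>] by metis
    \<comment> \<open>The intermediate point is \<open>s (Suc n) = f (s n)\<close>: it is near
      \<open>f x\<close> because \<open>f\<close> does not increase distances at \<open>t\<close>,
      and near \<open>x\<close> by convergence.\<close>
    have close: "1 - \<alpha> < \<F> (f x) x (ereal t)" if \<alpha>: "\<alpha> \<in> {0<..<1}" for \<alpha>
    proof -
      obtain n where n: "\<And>m. m \<ge> n \<Longrightarrow> 1 - \<alpha> < \<F> (s m) x (ereal t)"
        using lim \<alpha> \<open>0 < t\<close> unfolding PM_converges_def s_def by blast
      have "1 - \<F> (f (s n)) (f x) (ereal t) \<le> k * (1 - \<F> (s n) x (ereal t))"
        by (rule c[OF s \<open>x \<in> X\<close>])
      also have "\<dots> \<le> 1 - \<F> (s n) x (ereal t)"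
        using k distance_df_bounds(2)[OF PM_space_dfs[OF PM s \<open>x \<in> X\<close>]]
        by (intro mult_left_le_one_le) auto
      finally have "1 - \<alpha> < \<F> (s (Suc n)) (f x) (ereal t)"
        using n[of n] by (simp add: s_def)
      moreover have "\<F> (s (Suc n)) (f x) = \<F> (f x) (s (Suc n))"
        by (rule PM_space_sym[OF PM s fx])
      moreover have "1 - \<alpha> < \<F> (s (Suc n)) x (ereal t)"
        by (rule n) simp
      ultimately show ?thesis
        using PM_space_ultrametric[OF T PM fx s \<open>x \<in> X\<close>, of t "Suc n"] \<open>0 < t\<close>
        by (auto simp: min_def split: if_splits)
    qed
    have bounds: "0 \<le> \<F> (f x) x (ereal t)" "\<F> (f x) x (ereal t) \<le> 1"
      using distance_df_bounds[OF PM_space_dfs[OF PM fx \<open>x \<in> X\<close>]] by auto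
    show "\<F> (f x) x (ereal t) = 1"
    proof (rule ccontr)
      assume "\<F> (f x) x (ereal t) \<noteq> 1"
      \<comment> \<open>Halving keeps the value below 1 even if
        \<open>\<F> (f x) x (ereal t)\<close> is 0. Then \<open>close\<close> makes a positive
        distance smaller than its own half.\<close>
      then have "(1 - \<F> (f x) x (ereal t)) / 2 \<in> {0<..<1}"
        using bounds by auto
      from close[OF this] show False
        using bounds by (simp add: field_simps)
    qed
  qed
qed

theorem theorem4p2:
  fixes T :: "real \<Rightarrow> real \<Rightarrow> real"
    and X :: "'a set"
    and \<F> :: "'a \<Rightarrow> 'a \<Rightarrow> ereal \<Rightarrow> real"
    and f :: "'a \<Rightarrow> 'a"
  assumes "left_continuous_t_norm T"
    and "\<And>\<alpha>. \<alpha> \<in> {0..1} \<Longrightarrow> T \<alpha> \<alpha> \<ge> \<alpha>"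
    and "PM_space X \<F> (tau_of T)"
    and "PM_complete X \<F>"
    and "f \<in> X \<rightarrow> X"
    and "TSR_contraction X \<F> f"
  shows "\<exists>!x. x \<in> X \<and> f x = x"
proof -
  have T: "t_norm T"
    using assms(1) unfolding left_continuous_t_norm_def by blast
  \<comment> \<open>A PM space is nonempty, which supplies an arbitrary starting point for the
    Picard iteration.\<close>
  obtain x0 where x0: "x0 \<in> X"
    using assms(3) unfolding PM_space_def by blast
  have "(f ^^ n) x0 \<in> X" for n
    using assms(5) x0 by (induction n) auto
  then have "range (\<lambda>n. (f ^^ n) x0) \<subseteq> X"
    by auto
  moreover have "PM_Cauchy \<F> (\<lambda>n. (f ^^ n) x0)"
    by (rule TSR_contraction_iterates_Cauchy[OF T assms(2,3,5,6) x0])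
  ultimately obtain x where x: "x \<in> X" "PM_converges \<F> (\<lambda>n. (f ^^ n) x0) x"
    using assms(4)[unfolded PM_complete_def, rule_format, of "\<lambda>n. (f ^^ n) x0"] by auto
  have "f x = x"
    by (rule TSR_contraction_limit_fixed[OF T assms(2,3,5,6) x0 x])
  with x(1) show ?thesis
    by (blast intro: TSR_contraction_fixed_point_unique[OF assms(3,5,6)])
qed

end
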